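(* Let $\big((d_1^+,\dots,d_n^+),(d_1^-,\dots,d_n^-)\big)$ be a directed degree sequence, and let $$m=\sum_{i=1}^n d_i^+\quad\text{and}\quad m^*=\sum_{i=1}^n\left[\min(d_i^+,n-d_i^+)+\min(d_i^-,n-d_i^-)\right].$$ Then for all pairs of realizations $\vec G_1,\vec G_2$ of this directed degree sequence, $$\mathbf{dist}_d(\vec G_1,\vec G_2)\le H'(\vec G_1,\vec G_2)\cdot\left(1-\frac1n\right)\le m^*\left(\frac12-\frac1{2n}\right)\le m\left(1-\frac1n\right).$$
   Context: Directed graphs are finite, without loops and without parallel edges (both $xy$ and $yx$ may be present), with labeled vertices $x_1,\dots,x_n$. The directed degree sequence of $\vec G$ is the pair of sequences of out-degrees $d_i^+$ and in-degrees $d_i^-$ of the vertices $x_i$; $\vec G$ is then called a realization of this pair. Swaps: (1) A $C_4$-swap: for four distinct vertices $x,y,z,t$ with $xy,zt$ directed edges and $xt,zy$ not directed edges, replace $xy,zt$ by $xt,zy$. (2) A triangular $C_6$-swap: for three distinct vertices $x,y,z$ such that $xy,yz,zx$ are directed edges and $yx,zy,xz$ are not, replace $xy,yz,zx$ by $yx,zy,xz$. Only these two types of swaps are allowed. A $C_4$-swap has weight $1$, a triangular $C_6$-swap has weight $2$. $\mathbf{dist}_d(\vec G_1,\vec G_2)$ is the minimum total weight of a swap sequence transforming $\vec G_1$ into $\vec G_2$. $H'(\vec G_1,\vec G_2)=|E(\vec G_1)\,\Delta\, E(\vec G_2)|/2$, where $\Delta$ is the symmetric difference of the sets of directed edges.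 *)

theory Defs
  imports "Graph_Theory.Pair_Digraph" "HOL-Library.Extended_Real"
begin

text \<open>
  \<^locale>\<open>pair_digraph\<close> is a finite digraph without loops whose arcs are pairs of
  vertices, hence without parallel arcs; opposite arcs may both be present.
  The labeled vertices $x_1, \dots, x_n$ are the numbers \<open>1, \<dots>, n\<close>; \<open>dp\<close> and \<open>dm\<close> are the
  sequences of out-degrees and of in-degrees, and only their values on \<open>{1..n}\<close> matter.
\<close>

definition realization ::
    "nat \<Rightarrow> (nat \<Rightarrow> nat) \<Rightarrow> (nat \<Rightarrow> nat) \<Rightarrow> nat pair_pre_digraph \<Rightarrow> bool" where
  "realization n dp dm G \<longleftrightarrow>
     pair_digraph G \<and> pverts G = {1..n} \<and>
     (\<forall>i\<in>{1..n}. out_degree (with_proj G) i = dp i \<and> in_degree (with_proj G) i = dm i)"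

definition directed_degree_sequence :: "nat \<Rightarrow> (nat \<Rightarrow> nat) \<Rightarrow> (nat \<Rightarrow> nat) \<Rightarrow> bool" where
  "directed_degree_sequence n dp dm \<longleftrightarrow> (\<exists>G. realization n dp dm G)"

definition C4_swap :: "'a pair_pre_digraph \<Rightarrow> 'a pair_pre_digraph \<Rightarrow> bool" where
  "C4_swap G G' \<longleftrightarrow>
     (\<exists>x y z t. distinct [x, y, z, t] \<and> {x, y, z, t} \<subseteq> pverts G \<and>
        (x, y) \<in> parcs G \<and> (z, t) \<in> parcs G \<and>
        (x, t) \<notin> parcs G \<and> (z, y) \<notin> parcs G \<and>
        G' = G\<lparr>parcs := (parcs G - {(x, y), (z, t)}) \<union> {(x, t), (z, y)}\<rparr>)"

definition triangular_C6_swap :: "'a pair_pre_digraph \<Rightarrow> 'a pair_pre_digraph \<Rightarrow> bool" where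
  "triangular_C6_swap G G' \<longleftrightarrow>
     (\<exists>x y z. distinct [x, y, z] \<and> {x, y, z} \<subseteq> pverts G \<and>
        (x, y) \<in> parcs G \<and> (y, z) \<in> parcs G \<and> (z, x) \<in> parcs G \<and>
        (y, x) \<notin> parcs G \<and> (z, y) \<notin> parcs G \<and> (x, z) \<notin> parcs G \<and>
        G' = G\<lparr>parcs := (parcs G - {(x, y), (y, z), (z, x)}) \<union> {(y, x), (z, y), (x, z)}\<rparr>)"

text \<open>
  \<open>swap_sequence G1 w G2\<close>: some finite sequence of swaps of total weight \<open>w\<close> transforms
  \<open>G1\<close> into \<open>G2\<close>.
\<close>

inductive swap_sequence :: "'a pair_pre_digraph \<Rightarrow> nat \<Rightarrow> 'a pair_pre_digraph \<Rightarrow> bool" where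
  Nil: "swap_sequence G 0 G"
| C4: "swap_sequence G w G' \<Longrightarrow> C4_swap G' G'' \<Longrightarrow> swap_sequence G (w + 1) G''"
| C6: "swap_sequence G w G' \<Longrightarrow> triangular_C6_swap G' G'' \<Longrightarrow> swap_sequence G (w + 2) G''"

text \<open>
  The infimum is taken in \<^typ>\<open>enat\<close>, so the distance is \<open>\<infinity>\<close> (and not \<open>0\<close>) if there is no
  swap sequence at all; otherwise it is the minimum.
\<close>

definition dist_d :: "'a pair_pre_digraph \<Rightarrow> 'a pair_pre_digraph \<Rightarrow> enat" where
  "dist_d G1 G2 = (INF w \<in> {w. swap_sequence G1 w G2}. enat w)"

definition H' :: "'a pair_pre_digraph \<Rightarrow> 'a pair_pre_digraph \<Rightarrow> real" where
  "H' G1 G2 = real (card ((parcs G1 - parcs G2) \<union> (parcs G2 - parcs G1))) / 2"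

end

theory Submission
  imports Defs "HOL-Library.Multiset"
begin

text \<open>
  In the bipartite representation (tails on one side, heads on the other), the difference of two
  realizations contains an alternating cycle through \<open>k \<le> n\<close> tails and \<open>k\<close> heads. Such a cycle can
  be exchanged by swaps of total weight \<open>k - 1\<close>: for \<open>k = 2\<close> it is a \<open>C\<^sub>4\<close>-swap, and for larger \<open>k\<close>
  a chord cuts off a 4-cycle. Only chords joining the two copies of one vertex are forbidden;
  every tail meets at most one of them, so that a usable chord always exists for \<open>k \<ge> 4\<close>, while for
  \<open>k = 3\<close> all three chords are forbidden only if the cycle is a triangular \<open>C\<^sub>6\<close>-swap.
  Thus removing \<open>k\<close> arcs from the difference costs \<open>k - 1 \<le> k (1 - 1/n)\<close>.
\<close>

section \<open>Composing exchanges of arcs\<close>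

lemma swap_sequence_trans:
  assumes "swap_sequence G v G'" and "swap_sequence G' w G''"
  shows "swap_sequence G (v + w) G''"
  using assms(2,1)
proof (induction rule: swap_sequence.induct)
  case (Nil G)
  then show ?case by simp
next
  case (C4 G w G' G'')
  then show ?case
    using swap_sequence.C4 by (metis add.assoc)
next
  case (C6 G w G' G'')
  then show ?case
    using swap_sequence.C6 by (metis add.assoc)
qed

text \<open>Quantifying over all digraphs on \<open>V\<close> makes the exchange independent of the
  remaining arcs, so partial exchanges can be carried out in whichever order a chord
  requires.\<close>

definition swappable :: "'a set \<Rightarrow> nat \<Rightarrow> ('a \<times> 'a) set \<Rightarrow> ('a \<times> 'a) set \<Rightarrow> bool" where
  "swappable V w R B \<longleftrightarrow>
     (\<forall>G :: 'a pair_pre_digraph.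
        pverts G = V \<longrightarrow> R \<subseteq> parcs G \<longrightarrow> B \<inter> parcs G = {} \<longrightarrow>
        swap_sequence G w (G\<lparr>parcs := parcs G - R \<union> B\<rparr>))"

lemma swappableD:
  assumes "swappable V w R B" "pverts G = V" "R \<subseteq> parcs G" "B \<inter> parcs G = {}"
  shows "swap_sequence G w (G\<lparr>parcs := parcs G - R \<union> B\<rparr>)"
  using assms unfolding swappable_def by blast

text \<open>
  The arc \<open>p\<close> is a chord splitting an alternating cycle into two. If \<open>p\<close> is absent from the
  digraph, the part in which it has to be inserted is processed first, otherwise the other one.
\<close>

lemma swappable_splice:
  assumes 1: "swappable V v R1 (insert p B1)" and 2: "swappable V w (insert p R2) B2"
    and p: "p \<notin> R1 \<union> B1 \<union> R2 \<union> B2"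
    and dis: "R1 \<inter> R2 = {}" "B1 \<inter> B2 = {}"
  shows "swappable V (v + w) (R1 \<union> R2) (B1 \<union> B2)"
  unfolding swappable_def
proof (intro allI impI)
  fix G :: "'a pair_pre_digraph"
  assume V: "pverts G = V" and R: "R1 \<union> R2 \<subseteq> parcs G"
    and B: "(B1 \<union> B2) \<inter> parcs G = {}"
  show "swap_sequence G (v + w) (G\<lparr>parcs := parcs G - (R1 \<union> R2) \<union> (B1 \<union> B2)\<rparr>)"
  proof (cases "p \<in> parcs G")
    case False
    define G' where "G' = G\<lparr>parcs := parcs G - R1 \<union> insert p B1\<rparr>"
    have "swap_sequence G v G'"
      unfolding G'_def by (rule swappableD[OF 1 V]) (use R B False in auto)
    moreover have "swap_sequence G' w (G'\<lparr>parcs := parcs G' - insert p R2 \<union> B2\<rparr>)"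
      by (rule swappableD[OF 2]) (use V R B p dis in \<open>auto simp: G'_def\<close>)
    moreover have "parcs G - R1 \<union> insert p B1 - insert p R2 \<union> B2
        = parcs G - (R1 \<union> R2) \<union> (B1 \<union> B2)"
      using False R B p by blast
    ultimately show ?thesis
      by (auto simp: G'_def dest: swap_sequence_trans)
  next
    case True
    define G' where "G' = G\<lparr>parcs := parcs G - insert p R2 \<union> B2\<rparr>"
    have "swap_sequence G w G'"
      unfolding G'_def by (rule swappableD[OF 2 V]) (use R B True in auto)
    moreover have "swap_sequence G' v (G'\<lparr>parcs := parcs G' - R1 \<union> insert p B1\<rparr>)"
      by (rule swappableD[OF 1]) (use V R B p dis in \<open>auto simp: G'_def\<close>)
    moreover have "parcs G - insert p R2 \<union> B2 - R1 \<union> insert p B1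
        = parcs G - (R1 \<union> R2) \<union> (B1 \<union> B2)"
      using True R B p by blast
    ultimately show ?thesis
      by (auto simp: G'_def add.commute[of v w] dest: swap_sequence_trans)
  qed
qed

lemma swappable_C4:
  assumes "distinct [x, y, z, t]" "{x, y, z, t} \<subseteq> V"
  shows "swappable V 1 {(x, y), (z, t)} {(x, t), (z, y)}"
  unfolding swappable_def
proof (intro allI impI)
  fix G :: "'a pair_pre_digraph"
  assume "pverts G = V" "{(x, y), (z, t)} \<subseteq> parcs G" "{(x, t), (z, y)} \<inter> parcs G = {}"
  then have "C4_swap G (G\<lparr>parcs := parcs G - {(x, y), (z, t)} \<union> {(x, t), (z, y)}\<rparr>)"
    using assms unfolding C4_swap_def
    by (intro exI[of _ x] exI[of _ y] exI[of _ z] exI[of _ t]) simp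
  from swap_sequence.C4[OF swap_sequence.Nil this]
  show "swap_sequence G 1 (G\<lparr>parcs := parcs G - {(x, y), (z, t)} \<union> {(x, t), (z, y)}\<rparr>)"
    by simp
qed

lemma swappable_C6:
  assumes "distinct [x, y, z]" "{x, y, z} \<subseteq> V"
  shows "swappable V 2 {(x, y), (y, z), (z, x)} {(y, x), (z, y), (x, z)}"
  unfolding swappable_def
proof (intro allI impI)
  fix G :: "'a pair_pre_digraph"
  assume "pverts G = V" "{(x, y), (y, z), (z, x)} \<subseteq> parcs G"
    "{(y, x), (z, y), (x, z)} \<inter> parcs G = {}"
  then have "triangular_C6_swap G
      (G\<lparr>parcs := parcs G - {(x, y), (y, z), (z, x)} \<union> {(y, x), (z, y), (x, z)}\<rparr>)"
    using assms unfolding triangular_C6_swap_def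
    by (intro exI[of _ x] exI[of _ y] exI[of _ z]) simp
  from swap_sequence.C6[OF swap_sequence.Nil this]
  show "swap_sequence G 2
      (G\<lparr>parcs := parcs G - {(x, y), (y, z), (z, x)} \<union> {(y, x), (z, y), (x, z)}\<rparr>)"
    by (simp add: numeral_2_eq_2)
qed

section \<open>Exchanging a single alternating cycle\<close>

text \<open>
  A list \<open>[(u\<^sub>1, v\<^sub>1), \<dots>, (u\<^sub>k, v\<^sub>k)]\<close> encodes the closed walk \<open>u\<^sub>1 v\<^sub>1 u\<^sub>2 v\<^sub>2 \<dots> u\<^sub>k v\<^sub>k\<close> in the
  bipartite representation: the arcs of the list are to be deleted, the shifted ones
  \<open>(u\<^sub>i\<^sub>+\<^sub>1, v\<^sub>i)\<close> are to be inserted.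
\<close>

definition shifted :: "('a \<times> 'a) list \<Rightarrow> ('a \<times> 'a) list" where
  "shifted ps = zip (rotate1 (map fst ps)) (map snd ps)"

text \<open>Tails and heads are distinct separately: a vertex may occur once in each role, as two
  nodes of the bipartite cycle. The last conjunct forbids loops among the deleted and the inserted
  arcs.\<close>

definition cycle_list :: "'a set \<Rightarrow> ('a \<times> 'a) list \<Rightarrow> bool" where
  "cycle_list V ps \<longleftrightarrow> distinct (map fst ps) \<and> distinct (map snd ps) \<and>
     fst ` set ps \<subseteq> V \<and> snd ` set ps \<subseteq> V \<and> (\<forall>(x, y) \<in> set ps \<union> set (shifted ps). x \<noteq> y)"

lemma zip_rotate1:
  assumes "length xs = length ys"
  shows "zip (rotate1 xs) (rotate1 ys) = rotate1 (zip xs ys)"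
  using assms by (cases xs; cases ys) auto

text \<open>Rotation only moves the starting point of the closed walk; this brings any chord to the
  front of the list, where the chord lemmas below expect it.\<close>

lemma set_shifted_rotate1 [simp]: "set (shifted (rotate1 ps)) = set (shifted ps)"
  by (simp add: shifted_def zip_rotate1 flip: rotate1_map)

lemma cycle_list_rotate1 [simp]: "cycle_list V (rotate1 ps) \<longleftrightarrow> cycle_list V ps"
  by (simp add: cycle_list_def flip: rotate1_map)

text \<open>With two tails, every tail-head pair is deleted or inserted, so the absence of loops
  already makes the four vertices distinct.\<close>

lemma swappable_cycle2:
  assumes "cycle_list V [(a, b), (c, d)]"
  shows "swappable V 1 {(a, b), (c, d)} {(a, d), (c, b)}"
  by (rule swappable_C4) (use assms in \<open>auto simp: cycle_list_def shifted_def\<close>)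

lemma set_zip_subset: "set (zip xs ys) \<subseteq> set xs \<times> set ys"
  by (auto dest: set_zip_leftD set_zip_rightD)

text \<open>The chord \<open>(a, d)\<close> cuts off the 4-cycle on tails \<open>a\<close>,
  \<open>c\<close> and heads \<open>b\<close>, \<open>d\<close>. The 4-cycle inserts the chord, and
  the remaining cycle, shorter by one arc, deletes it.\<close>

lemma swappable_chord_insert:
  assumes cyc: "cycle_list V ((a, b) # (c, d) # (e, f) # ps)" and "a \<noteq> d"
    and IH: "\<And>qs. cycle_list V qs \<Longrightarrow> length qs = length ps + 2 \<Longrightarrow>
      swappable V (length ps + 1) (set qs) (set (shifted qs))"
  shows "swappable V (length ps + 2) (set ((a, b) # (c, d) # (e, f) # ps))
    (set (shifted ((a, b) # (c, d) # (e, f) # ps)))"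
proof -
  \<comment> \<open>\<open>T\<close> holds the inserted arcs from head \<open>f\<close> onwards; the
    full cycle and the shortened one share them.\<close>
  define T where "T = zip (map fst ps @ [a]) (f # map snd ps)"
  have T0: "set T \<subseteq> insert a (fst ` set ps) \<times> insert f (snd ` set ps)"
    unfolding T_def using set_zip_subset[of "map fst ps @ [a]" "f # map snd ps"] by auto
  have dis: "distinct [a, c, e]" "distinct [b, d, f]"
    "\<forall>x\<in>{a, c, e}. x \<notin> fst ` set ps" "\<forall>y\<in>{b, d, f}. y \<notin> snd ` set ps"
    using cyc unfolding cycle_list_def by simp_all
  have T: "x \<notin> {c, e} \<and> y \<notin> {b, d}" if "(x, y) \<in> set T" for x y
    using subsetD[OF T0 that] dis by (simp del: image_iff, metis)
  have ps: "x \<notin> {a, c, e} \<and> y \<notin> {b, d, f}" if "(x, y) \<in> set ps" for x y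
    using imageI[OF that, of fst] imageI[OF that, of snd] dis(3,4) by (metis fst_conv snd_conv)
  have long: "swappable V (length ps + 1) (insert (a, d) (set ((e, f) # ps))) (insert (e, d) (set T))"
    using IH[of "(a, d) # (e, f) # ps"] cyc \<open>a \<noteq> d\<close>
    by (auto simp: cycle_list_def shifted_def T_def)
  have short: "swappable V 1 {(a, b), (c, d)} (insert (a, d) {(c, b)})"
    by (rule swappable_cycle2) (use cyc \<open>a \<noteq> d\<close> in \<open>auto simp: cycle_list_def shifted_def\<close>)
  have "swappable V (1 + (length ps + 1)) ({(a, b), (c, d)} \<union> set ((e, f) # ps))
      ({(c, b)} \<union> insert (e, d) (set T))"
    by (rule swappable_splice[OF short long])
      (use dis(1,2) T ps in auto)
  moreover have "set (shifted ((a, b) # (c, d) # (e, f) # ps)) = {(c, b)} \<union> insert (e, d) (set T)"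
    by (auto simp: shifted_def T_def)
  ultimately show ?thesis by (simp add: insert_commute)
qed

text \<open>Dual to \<open>swappable_chord_insert\<close>: the chord \<open>(e, b)\<close> is
  inserted by the shortened cycle and deleted by the 4-cycle on tails \<open>c\<close>,
  \<open>e\<close> and heads \<open>b\<close>, \<open>d\<close>.\<close>

lemma swappable_chord_delete:
  assumes cyc: "cycle_list V ((a, b) # (c, d) # (e, f) # ps)" and "e \<noteq> b"
    and IH: "\<And>qs. cycle_list V qs \<Longrightarrow> length qs = length ps + 2 \<Longrightarrow>
      swappable V (length ps + 1) (set qs) (set (shifted qs))"
  shows "swappable V (length ps + 2) (set ((a, b) # (c, d) # (e, f) # ps))
    (set (shifted ((a, b) # (c, d) # (e, f) # ps)))"
proof -
  define T where "T = zip (map fst ps @ [a]) (f # map snd ps)"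
  have T0: "set T \<subseteq> insert a (fst ` set ps) \<times> insert f (snd ` set ps)"
    unfolding T_def using set_zip_subset[of "map fst ps @ [a]" "f # map snd ps"] by auto
  have dis: "distinct [a, c, e]" "distinct [b, d, f]"
    "\<forall>x\<in>{a, c, e}. x \<notin> fst ` set ps" "\<forall>y\<in>{b, d, f}. y \<notin> snd ` set ps"
    using cyc unfolding cycle_list_def by simp_all
  have T: "x \<notin> {c, e} \<and> y \<notin> {b, d}" if "(x, y) \<in> set T" for x y
    using subsetD[OF T0 that] dis by (simp del: image_iff, metis)
  have ps: "x \<notin> {a, c, e} \<and> y \<notin> {b, d, f}" if "(x, y) \<in> set ps" for x y
    using imageI[OF that, of fst] imageI[OF that, of snd] dis(3,4) by (metis fst_conv snd_conv)
  have long: "swappable V (length ps + 1) (set ((a, b) # (e, f) # ps)) (insert (e, b) (set T))"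
    using IH[of "(a, b) # (e, f) # ps"] cyc \<open>e \<noteq> b\<close>
    by (auto simp: cycle_list_def shifted_def T_def)
  have short: "swappable V 1 (insert (e, b) {(c, d)}) {(e, d), (c, b)}"
    by (rule swappable_cycle2) (use cyc \<open>e \<noteq> b\<close> in \<open>auto simp: cycle_list_def shifted_def\<close>)
  have "swappable V ((length ps + 1) + 1) (set ((a, b) # (e, f) # ps) \<union> {(c, d)})
      (set T \<union> {(e, d), (c, b)})"
    by (rule swappable_splice[OF long short])
      (use dis(1,2) T ps in auto)
  moreover have "set (shifted ((a, b) # (c, d) # (e, f) # ps)) = set T \<union> {(e, d), (c, b)}"
    by (auto simp: shifted_def T_def)
  moreover have "set ((a, b) # (e, f) # ps) \<union> {(c, d)} = set ((a, b) # (c, d) # (e, f) # ps)"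
    by auto
  ultimately show ?thesis by (simp del: list.set)
qed

lemma swappable_cycle:
  assumes "cycle_list V ps" and "length ps \<ge> 2"
  shows "swappable V (length ps - 1) (set ps) (set (shifted ps))"
  using assms
proof (induction "length ps" arbitrary: ps rule: less_induct)
  case less
  note cyc = less.prems(1)
  show ?case
  proof (cases "length ps = 2")
    case True
    then obtain a b c d where ps: "ps = [(a, b), (c, d)]"
      by (auto simp: numeral_2_eq_2 length_Suc_conv)
    have "shifted ps = [(c, b), (a, d)]" by (simp add: ps shifted_def)
    with swappable_cycle2[of V a b c d] cyc show ?thesis
      by (simp add: ps insert_commute)
  next
    case not2: False
    show ?thesis
    proof (cases "length ps = 3")
      case True
      have IH: "swappable V (length [] + 1) (set qs) (set (shifted qs))"
        if "cycle_list V qs" "length qs = length [] + 2" for qs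
        using less.hyps[of qs] True that by simp
      obtain a b c d e f where ps: "ps = [(a, b), (c, d), (e, f)]"
        using True by (auto simp: numeral_3_eq_3 length_Suc_conv)
      \<comment> \<open>The three chords of the hexagon are \<open>(a, d)\<close>,
        \<open>(c, f)\<close> and \<open>(e, b)\<close>; the last case is that all of them are
        loops.\<close>
      consider "a \<noteq> d" | "c \<noteq> f" | "e \<noteq> b" | "d = a" "f = c" "b = e" by blast
      then show ?thesis
      proof cases
        case 1
        then show ?thesis
          using swappable_chord_insert[of V a b c d e f "[]", OF _ _ IH] cyc by (simp add: ps)
      next
        case 2
        have "cycle_list V (rotate1 ps)" using cyc by simp
        then show ?thesis
          using swappable_chord_insert[of V c d e f a b "[]", OF _ 2 IH]
            set_shifted_rotate1[of ps]
          by (simp add: ps insert_commute)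
      next
        case 3
        then show ?thesis
          using swappable_chord_delete[of V a b c d e f "[]", OF _ _ IH] cyc by (simp add: ps)
      next
        case 4
        \<comment> \<open>Tails and heads are now the same three vertices, and the exchange reverses
          the triangle \<open>a\<close>, \<open>e\<close>, \<open>c\<close>.\<close>
        have "swappable V 2 {(a, e), (e, c), (c, a)} {(e, a), (c, e), (a, c)}"
          by (rule swappable_C6) (use cyc in \<open>auto simp: ps 4 cycle_list_def shifted_def\<close>)
        then show ?thesis
          by (simp add: ps 4 shifted_def insert_commute numeral_2_eq_2)
      qed
    next
      case False
      then have "length ps \<ge> 4" using not2 less.prems(2) by simp
      then obtain a b c d e f g h rs where ps: "ps = (a, b) # (c, d) # (e, f) # (g, h) # rs"
        by (auto simp: numeral_eq_Suc Suc_le_length_iff)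
      have IH: "swappable V (length qs' + 1) (set qs) (set (shifted qs))"
        if "cycle_list V qs" "length qs = length qs' + 2" "length qs' = length rs + 1"
        for qs qs' :: "('a \<times> 'a) list"
        using less.hyps[of qs] ps that by simp
      \<comment> \<open>The tail \<open>e\<close> cannot equal both heads, so one of the chords
        \<open>(e, b)\<close> and \<open>(e, h)\<close> is not a loop.\<close>
      have "b \<noteq> h" using cyc by (auto simp: ps cycle_list_def)
      then consider "e \<noteq> b" | "e \<noteq> h" by blast
      then show ?thesis
      proof cases
        case 1
        then show ?thesis
          using swappable_chord_delete[of V a b c d e f "(g, h) # rs", OF _ 1 IH] cyc
          by (simp add: ps)
      next
        case 2
        \<comment> \<open>Two rotations put \<open>(e, f)\<close> first, and \<open>(e, h)\<close>
          becomes the chord of \<open>swappable_chord_insert\<close>. If \<open>rs\<close> is empty,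
          \<open>(k, l)\<close> is \<open>(a, b)\<close>.\<close>
        let ?qs = "rotate1 (rotate1 ps)"
        obtain k l ts where qs: "?qs = (e, f) # (g, h) # (k, l) # ts"
          and len: "length ts = length rs + 1"
          by (cases rs) (auto simp: ps)
        have "cycle_list V ?qs" using cyc by simp
        then have "swappable V (length ts + 2) (set ?qs) (set (shifted ?qs))"
          unfolding qs by (rule swappable_chord_insert[OF _ 2 IH]) (use len in simp_all)
        then show ?thesis
          using ps len by (simp only: set_shifted_rotate1 set_rotate1) simp
      qed
    qed
  qed
qed

section \<open>Alternating cycles in the difference of two arc sets\<close>

text \<open>Iterating \<open>f\<close> on a finite set must repeat a value, so periodic points
  exist; \<open>us\<close> is the orbit of one, listed in order.\<close>

lemma self_map_cycle:
  assumes "finite S" "S \<noteq> {}" and closed: "f ` S \<subseteq> S"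
  obtains us where "us \<noteq> []" "distinct us" "set us \<subseteq> S" "rotate1 us = map f us"
proof -
  have iter: "(f ^^ i) x \<in> S" if "x \<in> S" for i x
    using that closed by (induction i) auto
  \<comment> \<open>The period is minimized over all points of \<open>S\<close>: a repetition inside
    the orbit then yields a point of smaller period, without being traced back to
    \<open>x\<close>.\<close>
  define P where "P k \<longleftrightarrow> k > 0 \<and> (\<exists>x\<in>S. (f ^^ k) x = x)" for k
  obtain x0 where x0: "x0 \<in> S" using assms(2) by blast
  have "\<not> inj (\<lambda>i. (f ^^ i) x0)"
    using iter[OF x0] assms(1) by (metis finite_subset image_subsetI infinite_UNIV_nat inj_on_finite)
  then obtain i j where ij: "i < j" "(f ^^ i) x0 = (f ^^ j) x0"
    unfolding inj_def by (metis linorder_neqE_nat)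
  have "(f ^^ (j - i)) ((f ^^ i) x0) = (f ^^ i) x0"
    using ij funpow_add[of "j - i" i f] by simp
  then have "P (j - i)" unfolding P_def using ij(1) iter[OF x0] by auto
  define k where "k = (LEAST k. P k)"
  have "P k" unfolding k_def by (rule LeastI) fact
  then obtain x where k: "k > 0" and x: "x \<in> S" "(f ^^ k) x = x" unfolding P_def by blast
  have least: "k \<le> l" if "P l" for l unfolding k_def using that by (rule Least_le)
  define us where "us = map (\<lambda>i. (f ^^ i) x) [0..<k]"
  have neq: "(f ^^ i) x \<noteq> (f ^^ j) x" if "i < j" "j < k" for i j
  proof
    assume eq: "(f ^^ i) x = (f ^^ j) x"
    have "(f ^^ (j - i)) ((f ^^ i) x) = (f ^^ i) x"
      using eq that funpow_add[of "j - i" i f] by simp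
    then have "P (j - i)" unfolding P_def using that iter[OF x(1)] by auto
    then show False using least that by fastforce
  qed
  have "inj_on (\<lambda>i. (f ^^ i) x) {0..<k}"
    by (rule linorder_inj_onI) (use neq in auto)
  then have "distinct us" by (simp add: us_def distinct_map)
  moreover have "rotate1 us = map f us"
  proof (rule nth_equalityI)
    fix i assume "i < length (rotate1 us)"
    then have i: "i < k" by (simp add: us_def)
    then have "rotate1 us ! i = us ! (Suc i mod k)"
      by (simp add: nth_rotate1 us_def)
    also have "\<dots> = (f ^^ Suc i) x"
      using i x(2) k by (cases "Suc i = k") (auto simp: us_def)
    finally show "rotate1 us ! i = map f us ! i" using i by (simp add: us_def)
  qed simp
  ultimately show ?thesis
    using k iter[OF x(1)] by (intro that[of us]) (auto simp: us_def)
qed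

text \<open>From a tail \<open>u\<close>, a chosen arc of \<open>D1\<close> leads to the head
  \<open>h u\<close>, and a chosen arc of \<open>D2\<close> leads back to the tail
  \<open>g (h u)\<close>. A cycle of the self-map \<open>g \<circ> h\<close> on the tails of
  \<open>D1\<close> is the required alternating cycle.\<close>

lemma alternating_cycle_exists:
  assumes fin: "finite D1" and ne: "D1 \<noteq> {}" and dis: "D1 \<inter> D2 = {}"
    and tails: "fst ` D2 \<subseteq> fst ` D1" and heads: "snd ` D1 \<subseteq> snd ` D2"
  obtains ps where "length ps \<ge> 2" "distinct (map fst ps)" "distinct (map snd ps)"
    "set ps \<subseteq> D1" "set (shifted ps) \<subseteq> D2"
proof -
  have "\<forall>u\<in>fst ` D1. \<exists>v. (u, v) \<in> D1" by auto
  then obtain h where h: "\<And>u. u \<in> fst ` D1 \<Longrightarrow> (u, h u) \<in> D1" by metis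
  have "\<forall>v\<in>snd ` D1. \<exists>u. (u, v) \<in> D2" using heads by force
  then obtain g where g: "\<And>v. v \<in> snd ` D1 \<Longrightarrow> (g v, v) \<in> D2" by metis
  have gh: "(g (h u), h u) \<in> D2" if "u \<in> fst ` D1" for u
    using g h[OF that] by (metis imageI snd_conv)
  then have closed: "(g \<circ> h) ` fst ` D1 \<subseteq> fst ` D1"
    using tails by (metis (no_types, lifting) comp_apply fst_conv image_eqI image_subsetI subsetD)
  obtain us where us: "us \<noteq> []" "distinct us" "set us \<subseteq> fst ` D1"
      and rot: "rotate1 us = map (g \<circ> h) us"
    by (rule self_map_cycle[OF _ _ closed]) (use fin ne in auto)
  define ps where "ps = map (\<lambda>u. (u, h u)) us"
  have fsts: "map fst ps = us" and snds: "map snd ps = map h us"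
    by (simp_all add: ps_def comp_def)
  have shift: "shifted ps = map (\<lambda>u. (g (h u), h u)) us"
    by (simp add: shifted_def fsts snds rot zip_map_map zip_same_conv_map comp_def)
  have D1: "set ps \<subseteq> D1" using us(3) h by (auto simp: ps_def)
  have D2: "set (shifted ps) \<subseteq> D2" using us(3) gh by (auto simp: shift)
  \<comment> \<open>The heads are distinct because their images under \<open>g\<close> are the
    rotated tails.\<close>
  have "distinct (map (g \<circ> h) us)" using us(2) rot by (metis distinct1_rotate)
  then have "distinct (map h us)"
    by (metis distinct_map map_map)
  \<comment> \<open>A list of length 1 equals its own shift, so its arc would lie in both
    \<open>D1\<close> and \<open>D2\<close>.\<close>
  have "length ps \<noteq> 1"
  proof
    assume "length ps = 1"
    then obtain p where "ps = [p]" by (auto simp: length_Suc_conv)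
    then show False using D1 D2 dis by (cases p) (auto simp: shifted_def)
  qed
  moreover have "length ps \<noteq> 0" using us(1) by (simp add: ps_def)
  ultimately have "length ps \<ge> 2" by linarith
  then show ?thesis
    by (rule that[of ps])
      (simp_all only: fsts snds us(2) \<open>distinct (map h us)\<close> D1 D2)
qed

section \<open>Degrees as multisets, and the induction on the difference\<close>

lemma mset_rotate1: "mset (rotate1 xs) = mset xs"
  by (cases xs) auto

text \<open>For \<open>fst\<close> and \<open>snd\<close> these multisets record out-degrees and
  in-degrees. The arcs common to \<open>A\<close> and \<open>B\<close> cancel, so the two
  differences have the same degrees.\<close>

lemma image_mset_Diff_Int:
  assumes "finite A" "finite B" "image_mset f (mset_set A) = image_mset f (mset_set B)"
  shows "image_mset f (mset_set (A - B)) = image_mset f (mset_set (B - A))"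
proof -
  have "mset_set A = mset_set (A - B) + mset_set (A \<inter> B)"
    using assms(1) by (subst mset_set_Union[symmetric]) (auto intro: arg_cong[where f = mset_set])
  moreover have "mset_set B = mset_set (B - A) + mset_set (A \<inter> B)"
    using assms(2) by (subst mset_set_Union[symmetric]) (auto intro: arg_cong[where f = mset_set])
  ultimately show ?thesis using assms(3) by simp
qed

lemma image_mset_exchange:
  assumes "finite A" "R \<subseteq> A" "finite B" "A \<inter> B = {}"
    and "image_mset f (mset_set R) = image_mset f (mset_set B)"
  shows "image_mset f (mset_set (A - R \<union> B)) = image_mset f (mset_set A)"
proof -
  have "mset_set A = mset_set (A - R) + mset_set R"
    using assms(1,2) by (subst mset_set_Union[symmetric])
      (auto intro: arg_cong[where f = mset_set] finite_subset)
  moreover have "mset_set (A - R \<union> B) = mset_set (A - R) + mset_set B"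
    using assms by (intro mset_set_Union) auto
  ultimately show ?thesis using assms(5) by simp
qed

text \<open>Induction on the number of arcs of \<open>G1\<close> outside \<open>G2\<close>: each
  round exchanges one alternating cycle and keeps all degrees. The weight bound is cleared of
  denominators to stay in the natural numbers.\<close>

lemma swap_sequence_exists:
  assumes "finite V" "pverts G1 = V" "pverts G2 = V"
    and "parcs G1 \<subseteq> {(x, y) \<in> V \<times> V. x \<noteq> y}" "parcs G2 \<subseteq> {(x, y) \<in> V \<times> V. x \<noteq> y}"
    and "image_mset fst (mset_set (parcs G1)) = image_mset fst (mset_set (parcs G2))"
    and "image_mset snd (mset_set (parcs G1)) = image_mset snd (mset_set (parcs G2))"
  shows "\<exists>w. swap_sequence G1 w G2 \<and> card V * w \<le> (card V - 1) * card (parcs G1 - parcs G2)"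
  using assms(2,4,6,7)
proof (induction "card (parcs G1 - parcs G2)" arbitrary: G1 rule: less_induct)
  case less
  let ?E = "parcs G1" and ?F = "parcs G2"
  have "finite {(x, y) \<in> V \<times> V. x \<noteq> y}"
    by (rule finite_subset[of _ "V \<times> V"]) (use assms(1) in auto)
  then have fin: "finite ?E" "finite ?F"
    using less.prems(2) assms(5) finite_subset by blast+
  have diff: "image_mset f (mset_set (?E - ?F)) = image_mset f (mset_set (?F - ?E))"
    if "f = fst \<or> f = snd" for f
    using that less.prems(3,4) fin by (auto intro: image_mset_Diff_Int)
  have im: "f ` (?E - ?F) = f ` (?F - ?E)" if "f = fst \<or> f = snd" for f
    using arg_cong[OF diff[OF that], of set_mset] fin by simp
  show ?case
  proof (cases "?E - ?F = {}")
    case True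
    then have "?F - ?E = {}" using im[of fst] by auto
    with True have "?E = ?F" by blast
    then have "G1 = G2" using less.prems(1) assms(3) by simp
    then show ?thesis using swap_sequence.Nil by (intro exI[of _ 0]) simp
  next
    case False
    obtain ps where ps: "length ps \<ge> 2" "distinct (map fst ps)" "distinct (map snd ps)"
      "set ps \<subseteq> ?E - ?F" "set (shifted ps) \<subseteq> ?F - ?E"
      by (rule alternating_cycle_exists[of "?E - ?F" "?F - ?E"])
        (use fin False im in auto)
    have subV: "fst ` set ps \<subseteq> V" "snd ` set ps \<subseteq> V"
      using ps(4) less.prems(2) by force+
    have cyc: "cycle_list V ps"
      unfolding cycle_list_def using ps subV less.prems(2) assms(5) by blast
    define k where "k = length ps"
    define G' where "G' = G1\<lparr>parcs := ?E - set ps \<union> set (shifted ps)\<rparr>"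
    have seq: "swap_sequence G1 (k - 1) G'"
      unfolding G'_def k_def
      by (rule swappableD[OF swappable_cycle[OF cyc ps(1)] less.prems(1)]) (use ps in auto)
    have dist_shifted: "distinct (shifted ps)"
      unfolding shifted_def using ps(2) by (intro distinct_zipI1) auto
    have "mset_set (set ps) = mset ps" "mset_set (set (shifted ps)) = mset (shifted ps)"
      using ps(2) dist_shifted by (auto simp: mset_set_set distinct_map)
    \<comment> \<open>Shifting permutes the tails and leaves the heads in place.\<close>
    moreover have "mset (map fst (shifted ps)) = mset (map fst ps)"
      "mset (map snd (shifted ps)) = mset (map snd ps)"
      by (simp_all add: shifted_def mset_rotate1 del: mset_map)
    ultimately have deg: "image_mset f (mset_set (set ps)) = image_mset f (mset_set (set (shifted ps)))"
      if "f = fst \<or> f = snd" for f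
      using that by auto
    \<comment> \<open>Deleted arcs come from the difference and inserted ones lie in
      \<open>G2\<close>, so the difference loses exactly \<open>k\<close> arcs.\<close>
    have eq: "parcs G' - ?F = (?E - ?F) - set ps"
      using ps(4,5) by (auto simp: G'_def)
    have card_ps: "card (set ps) = k"
      using ps(2) by (simp add: k_def distinct_card distinct_map)
    have card: "card (?E - ?F) = card (parcs G' - ?F) + k"
      using ps(4) fin card_ps card_mono[of "?E - ?F" "set ps"]
      by (simp add: eq card_Diff_subset)
    have "k \<le> card V"
      using card_mono[OF assms(1) subV(1)] distinct_card[OF ps(2)] by (simp add: k_def)
    have "\<exists>w. swap_sequence G' w G2 \<and> card V * w \<le> (card V - 1) * card (parcs G' - ?F)"
    proof (rule less.hyps)
      show "card (parcs G' - ?F) < card (?E - ?F)" using card ps(1) unfolding k_def by linarith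
      show "pverts G' = V" using less.prems(1) by (simp add: G'_def)
      show "parcs G' \<subseteq> {(x, y) \<in> V \<times> V. x \<noteq> y}"
        using less.prems(2) ps(5) assms(5) by (auto simp: G'_def)
      have *: "image_mset f (mset_set (parcs G')) = image_mset f (mset_set ?E)"
        if "f = fst \<or> f = snd" for f
        unfolding G'_def using fin ps deg[OF that] by (simp, intro image_mset_exchange) auto
      show "image_mset fst (mset_set (parcs G')) = image_mset fst (mset_set ?F)"
        "image_mset snd (mset_set (parcs G')) = image_mset snd (mset_set ?F)"
        using * less.prems(3,4) by auto
    qed
    then obtain w where w: "swap_sequence G' w G2"
      "card V * w \<le> (card V - 1) * card (parcs G' - ?F)" by blast
    \<comment> \<open>Expanded, both sides are \<open>card V * k\<close> diminished by
      \<open>card V\<close> and by \<open>k\<close> respectively.\<close>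
    have "card V * (k - 1) \<le> (card V - 1) * k"
      using \<open>k \<le> card V\<close> by (simp add: diff_mult_distrib diff_mult_distrib2)
    then have "card V * (k - 1 + w) \<le> (card V - 1) * card (?E - ?F)"
      using w(2) by (simp add: card distrib_left)
    then show ?thesis
      using swap_sequence_trans[OF seq w(1)] by blast
  qed
qed

section \<open>Fibre counts and degree bounds\<close>

lemma count_image_mset_set:
  assumes "finite A"
  shows "count (image_mset f (mset_set A)) x = card {a \<in> A. f a = x}"
proof -
  have "count (image_mset f (mset_set A)) x = size (filter_mset (\<lambda>a. f a = x) (mset_set A))"
    by (induction A rule: infinite_finite_induct) auto
  then show ?thesis using assms by simp
qed

lemma card_eq_sum_fibres:
  assumes "finite A" "finite I" "f ` A \<subseteq> I"
  shows "card A = (\<Sum>i\<in>I. card {a \<in> A. f a = i})"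
  using sum.group[OF assms, of "\<lambda>_. 1 :: nat"] by simp

text \<open>In each fibre, \<open>A - B\<close> lies inside \<open>A\<close>, giving the bound
  \<open>d i\<close>; it is also disjoint from the \<open>d i\<close> elements of \<open>B\<close>
  among at most \<open>n\<close>, giving \<open>n - d i\<close>.\<close>

lemma card_Diff_le_sum_min:
  assumes "finite U" "A \<subseteq> U" "B \<subseteq> U" "finite I" "f ` U \<subseteq> I"
    and n: "\<And>i. i \<in> I \<Longrightarrow> card {e \<in> U. f e = i} \<le> n"
    and A: "\<And>i. i \<in> I \<Longrightarrow> card {e \<in> A. f e = i} = d i"
    and B: "\<And>i. i \<in> I \<Longrightarrow> card {e \<in> B. f e = i} = d i"
  shows "real (card (A - B)) \<le> (\<Sum>i\<in>I. min (real (d i)) (real n - real (d i)))"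
proof -
  have fin: "finite A" "finite B" using assms(1-3) finite_subset by auto
  have "card (A - B) = (\<Sum>i\<in>I. card {e \<in> A - B. f e = i})"
    by (rule card_eq_sum_fibres) (use fin assms(2,4,5) in auto)
  also have "real \<dots> \<le> (\<Sum>i\<in>I. min (real (d i)) (real n - real (d i)))"
    unfolding of_nat_sum
  proof (rule sum_mono)
    fix i assume i: "i \<in> I"
    have "card {e \<in> A - B. f e = i} \<le> card {e \<in> A. f e = i}"
      by (rule card_mono) (use fin in auto)
    moreover have "card {e \<in> A - B. f e = i} + card {e \<in> B. f e = i}
        = card ({e \<in> A - B. f e = i} \<union> {e \<in> B. f e = i})"
      by (rule card_Un_disjoint[symmetric]) (use fin in auto)
    moreover have "\<dots> \<le> card {e \<in> U. f e = i}"
      by (rule card_mono) (use assms(1-3) in auto)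
    ultimately show "real (card {e \<in> A - B. f e = i}) \<le> min (real (d i)) (real n - real (d i))"
      using n[OF i] A[OF i] B[OF i] by simp
  qed
  finally show ?thesis .
qed

lemma realizationD:
  assumes "realization n dp dm G"
  shows "pverts G = {1..n}" "parcs G \<subseteq> {(x, y) \<in> {1..n} \<times> {1..n}. x \<noteq> y}"
    "\<And>i. i \<in> {1..n} \<Longrightarrow> card {e \<in> parcs G. fst e = i} = dp i"
    "\<And>i. i \<in> {1..n} \<Longrightarrow> card {e \<in> parcs G. snd e = i} = dm i"
proof -
  interpret pair_digraph G using assms by (simp add: realization_def)
  show V: "pverts G = {1..n}" using assms by (simp add: realization_def)
  show "parcs G \<subseteq> {(x, y) \<in> {1..n} \<times> {1..n}. x \<noteq> y}"
    using arc_fst_in_verts arc_snd_in_verts pair_no_loops V by fastforce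
  show "\<And>i. i \<in> {1..n} \<Longrightarrow> card {e \<in> parcs G. fst e = i} = dp i"
    "\<And>i. i \<in> {1..n} \<Longrightarrow> card {e \<in> parcs G. snd e = i} = dm i"
    using assms by (auto simp: realization_def out_degree_def in_degree_def out_arcs_def in_arcs_def)
qed

section \<open>The chain of inequalities for two realizations\<close>

theorem theorem5p6:
  fixes n :: nat and dp dm :: "nat \<Rightarrow> nat" and m m_star :: real
    and G1 G2 :: "nat pair_pre_digraph"
  assumes "n \<ge> 1"
    and "directed_degree_sequence n dp dm"
    and "m = (\<Sum>i=1..n. real (dp i))"
    and "m_star = (\<Sum>i=1..n. min (real (dp i)) (real n - real (dp i))
                            + min (real (dm i)) (real n - real (dm i)))"
    and "realization n dp dm G1"
    and "realization n dp dm G2"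
  shows "ereal_of_enat (dist_d G1 G2) \<le> ereal (H' G1 G2 * (1 - 1 / real n))
       \<and> H' G1 G2 * (1 - 1 / real n) \<le> m_star * (1 / 2 - 1 / (2 * real n))
       \<and> m_star * (1 / 2 - 1 / (2 * real n)) \<le> m * (1 - 1 / real n)"
proof (intro conjI)
  let ?V = "{1..n}" and ?E = "parcs G1" and ?F = "parcs G2"
  note G1 = realizationD[OF assms(5)] and G2 = realizationD[OF assms(6)]
  have sub: "?E \<subseteq> ?V \<times> ?V" "?F \<subseteq> ?V \<times> ?V" using G1(2) G2(2) by auto
  have fin: "finite ?E" "finite ?F"
    using sub by (meson finite_SigmaI finite_atLeastAtMost finite_subset)+
  \<comment> \<open>Degrees are prescribed only on \<open>{1..n}\<close>; elsewhere both fibres are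
    empty, as equality of multisets requires.\<close>
  have fibre: "card {e \<in> ?E. f e = i} = card {e \<in> ?F. f e = i}" if f: "f = fst \<or> f = snd" for f i
  proof (cases "i \<in> ?V")
    case True
    then show ?thesis using f G1(3,4) G2(3,4) by auto
  next
    case False
    then have "{e \<in> ?E. f e = i} = {}" "{e \<in> ?F. f e = i} = {}"
      using f sub by auto
    then show ?thesis by (simp only:)
  qed
  have deg: "image_mset f (mset_set ?E) = image_mset f (mset_set ?F)" if "f = fst \<or> f = snd" for f
    by (rule multiset_eqI) (simp only: count_image_mset_set fin fibre[OF that])
  have "card (?E - ?F) = card (?F - ?E)"
    using arg_cong[OF image_mset_Diff_Int[OF fin deg[of fst]], of size] by simp
  moreover have symdiff: "card ((?E - ?F) \<union> (?F - ?E)) = card (?E - ?F) + card (?F - ?E)"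
    by (rule card_Un_disjoint) (use fin in auto)
  ultimately have H': "H' G1 G2 = real (card (?E - ?F))"
    by (simp add: H'_def)

  \<comment> \<open>This extracts the common factor \<open>1 - 1 / real n\<close>, reducing the last
    two inequalities to \<open>2 * H' G1 G2 \<le> m_star\<close> and
    \<open>m_star \<le> 2 * m\<close>.\<close>
  have half: "x * (1 / 2 - 1 / (2 * real n)) = x / 2 * (1 - 1 / real n)" for x :: real
    by (simp add: right_diff_distrib diff_divide_distrib)

  obtain w where w: "swap_sequence G1 w G2" "n * w \<le> (n - 1) * card (?E - ?F)"
    using swap_sequence_exists[OF _ G1(1) G2(1) G1(2) G2(2) deg deg] by auto
  have "real n * real w \<le> real (n - 1) * real (card (?E - ?F))"
    using w(2) by (metis of_nat_le_iff of_nat_mult)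
  then have "real w \<le> H' G1 G2 * (1 - 1 / real n)"
    using \<open>n \<ge> 1\<close> by (simp add: H' of_nat_diff field_simps)
  moreover have "dist_d G1 G2 \<le> enat w"
    unfolding dist_d_def using w(1) by (intro INF_lower) simp
  then have "ereal_of_enat (dist_d G1 G2) \<le> ereal (real w)"
    using ereal_of_enat_le_iff[of "dist_d G1 G2" "enat w"] by simp
  ultimately show "ereal_of_enat (dist_d G1 G2) \<le> ereal (H' G1 G2 * (1 - 1 / real n))"
    by (meson ereal_less_eq(3) order_trans)

  have row: "card {e \<in> ?V \<times> ?V. fst e = i} \<le> n" "card {e \<in> ?V \<times> ?V. snd e = i} \<le> n" for i
    using card_mono[of "{i} \<times> ?V" "{e \<in> ?V \<times> ?V. fst e = i}"]
      card_mono[of "?V \<times> {i}" "{e \<in> ?V \<times> ?V. snd e = i}"]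
    by (force simp: card_cartesian_product)+
  \<comment> \<open>One half of the symmetric difference is bounded through out-degrees, the other
    through in-degrees; together they give all of \<open>m_star\<close>.\<close>
  have "real (card (?E - ?F)) \<le> (\<Sum>i=1..n. min (real (dp i)) (real n - real (dp i)))"
    by (rule card_Diff_le_sum_min[where U = "?V \<times> ?V" and f = fst])
      (use sub row G1(3) G2(3) in auto)
  moreover have "real (card (?F - ?E)) \<le> (\<Sum>i=1..n. min (real (dm i)) (real n - real (dm i)))"
    by (rule card_Diff_le_sum_min[where U = "?V \<times> ?V" and f = snd])
      (use sub row G1(4) G2(4) in auto)
  ultimately have "2 * H' G1 G2 \<le> m_star"
    unfolding H'_def symdiff assms(4) sum.distrib by simp
  moreover have "1 - 1 / real n \<ge> 0" using \<open>n \<ge> 1\<close> by simp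
  ultimately show "H' G1 G2 * (1 - 1 / real n) \<le> m_star * (1 / 2 - 1 / (2 * real n))"
    unfolding half by (intro mult_right_mono) simp_all

  \<comment> \<open>Counting the arcs by tails and by heads shows that \<open>m\<close> is also the
    sum of the in-degrees.\<close>
  have "(\<Sum>i\<in>?V. card {e \<in> ?E. f e = i}) = card ?E" if "f = fst \<or> f = snd" for f
    by (rule card_eq_sum_fibres[symmetric]) (use that fin sub in auto)
  from this[of fst] this[of snd] have "(\<Sum>i=1..n. dp i) = (\<Sum>i=1..n. dm i)"
    using G1(3,4) by simp
  then have "m = (\<Sum>i=1..n. real (dm i))"
    unfolding assms(3) by (metis of_nat_sum)
  moreover have "m_star \<le> (\<Sum>i=1..n. real (dp i) + real (dm i))"
    unfolding assms(4) by (intro sum_mono add_mono) auto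
  ultimately have "m_star \<le> 2 * m"
    by (simp add: sum.distrib assms(3))
  then show "m_star * (1 / 2 - 1 / (2 * real n)) \<le> m * (1 - 1 / real n)"
    unfolding half using \<open>1 - 1 / real n \<ge> 0\<close> by (intro mult_right_mono) simp_all
qed

end
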